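(* Let $n$ be a positive integer and let $F = F(-n,b;\,c;\,z)$, where $b,c\in\mathbb{R}$ satisfy $$1-n<c-b<0,\qquad 1-n<b<0,\qquad 1-n<c<0.$$ Suppose $-j<b<-j+1$ with $j\in\{1,\dots,n-1\}$, $-k<c<-k+1$ with $k\in\{1,\dots,n-1\}$, and $-\ell<c-b<-\ell+1$ with $\ell\in\{1,\dots,n-1\}$. Then $F$ has no real zeros if $n+j+\ell$, $k+\ell$ and $j+k$ are all even, one real zero in $(1,\infty)$ if $n+j+\ell$ is odd, one real zero in $(0,1)$ if $k+\ell$ is odd, and one real negative zero if $j+k$ is odd.
   Context: For a positive integer $n$ and real $b,c$ with $c\notin\{0,-1,\dots,-n+1\}$, $F(-n,b;\,c;\,z)$ denotes the hypergeometric polynomial in the complex variable $z$ $$F(-n,b;\,c;\,z) = 1+\sum_{k=1}^{n} \frac{(-n)_k (b)_k}{(c)_k}\frac{z^k}{k!},\qquad (\alpha)_k = \alpha(\alpha+1)\cdots(\alpha+k-1).$$ *)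

theory Defs
  imports Complex_Main
begin

text \<open>The hypergeometric polynomial \<open>F(-n, b; c; z)\<close> for real parameters and complex argument.
  The leading \<open>1\<close> of the sum is the term \<open>k = 0\<close>, kept separate as in the classical formula.
  No denominator vanishes as long as \<open>c\<close> is none of \<open>0, -1, \<dots>, -n + 1\<close>.\<close>

definition hyp_poly :: "nat \<Rightarrow> real \<Rightarrow> real \<Rightarrow> complex \<Rightarrow> complex" where
  "hyp_poly n b c z =
     1 + (\<Sum>k = 1..n. of_real (pochhammer (- real n) k * pochhammer b k / pochhammer c k)
                       * z ^ k / fact k)"

end

theory Submission
  imports Defs "HOL-Computational_Algebra.Polynomial" "HOL-Computational_Algebra.Formal_Power_Series"
begin

text \<open>
  For real \<open>x\<close> the value \<open>F(x)\<close> is that of a real polynomial \<open>p\<close> of degree \<open>n\<close> satisfying Gauss's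
  equation \<open>x (1 - x) p'' + (c - (a + b + 1) x) p' = a b p\<close> with \<open>a = -n\<close>.

  On \<open>(0,1)\<close>, where \<open>x (1 - x) > 0\<close>, the condition \<open>a b > 0\<close> (that is, \<open>b < 0\<close>) makes
  \<open>p\<close> and \<open>p''\<close> have the same sign at every critical point, as for solutions of \<open>p'' = p\<close>.
  The zeros of \<open>p\<close> there are simple (\<open>gauss_equation_zero_simple\<close>), so critical points are not zeros.
  Hence \<open>p p'\<close> has positive derivative at each of its zeros, and so it vanishes at most once
  (\<open>unit_interval_at_most_one_zero\<close>). Thus \<open>p\<close> has at most one zero in \<open>(0,1)\<close>, counted with
  multiplicity, and whether there is one is decided by the signs of \<open>p\<close> at the endpoints
  (\<open>unit_interval_zero_count\<close>).

  The other two intervals are reduced to this one. The reversed polynomial \<open>x\<^sup>n p(1/x)\<close>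
  and the reflected polynomial \<open>p(1 - x)\<close> satisfy Gauss's equation with parameters \<open>b, c\<close> replaced by
  \<open>1 - n - c, 1 - n - b\<close> and \<open>b, 1 - n + b - c\<close>. The condition \<open>b < 0\<close> then becomes
  \<open>1 - n < c\<close> for the interval \<open>(1,\<infinity>)\<close> and \<open>c - b < 0\<close> for \<open>(-\<infinity>,0)\<close>.

  It remains to compute signs at \<open>0\<close>, \<open>1\<close> and infinity: \<open>p(0) = 1\<close>, the leading coefficient is
  \<open>(-1)\<^sup>n (b)\<^sub>n / (c)\<^sub>n\<close>, and \<open>p(1) = (c - b)\<^sub>n / (c)\<^sub>n\<close> by the Chu--Vandermonde identity. The products
  \<open>(b)\<^sub>n\<close>, \<open>(c)\<^sub>n\<close> and \<open>(c - b)\<^sub>n\<close> have exactly \<open>j\<close>, \<open>k\<close> and \<open>l\<close> negative factors and no zero factor,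
  hence the signs of \<open>(-1)\<^sup>j\<close>, \<open>(-1)\<^sup>k\<close> and \<open>(-1)\<^sup>l\<close>.
\<close>

section \<open>Polynomial solutions of Gauss's equation\<close>

definition gauss_equation :: "real \<Rightarrow> real \<Rightarrow> real \<Rightarrow> real poly \<Rightarrow> bool" where
  "gauss_equation a b c p \<longleftrightarrow>
     [:0, 1, -1:] * pderiv (pderiv p) + [:c, - (a + b + 1):] * pderiv p = smult (a * b) p"

text \<open>Comparing coefficients of \<open>x\<^sup>i\<close> gives the term ratio of the hypergeometric series; the factor on
  the right arises as \<open>i (i - 1) + (a + b + 1) i + a b\<close>.\<close>

lemma gauss_equation_iff_recurrence:
  "gauss_equation a b c p \<longleftrightarrow>
     (\<forall>i. (real i + 1) * (real i + c) * coeff p (Suc i) = (real i + a) * (real i + b) * coeff p i)"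
proof -
  let ?L = "[:0, 1, -1:] * pderiv (pderiv p) + [:c, - (a + b + 1):] * pderiv p"
  let ?R = "smult (a * b) p"
  have coeff_diff_sides: "coeff (?L - ?R) i
      = (real i + 1) * (real i + c) * coeff p (Suc i) - (real i + a) * (real i + b) * coeff p i"
    for i
  proof (cases i)
    case 0
    then show ?thesis by (simp add: coeff_pderiv)
  next
    case (Suc m)
    then show ?thesis
      by (cases m) (simp_all add: coeff_pderiv coeff_pCons algebra_simps)
  qed
  have "?L = ?R \<longleftrightarrow> (\<forall>i. coeff (?L - ?R) i = 0)"
    by (simp only: poly_eq_iff coeff_diff right_minus_eq)
  then show ?thesis
    by (simp only: gauss_equation_def coeff_diff_sides right_minus_eq)
qed

lemma gauss_equation_reflect:
  assumes "gauss_equation a b c p"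
  shows "gauss_equation a b (a + b + 1 - c) (pcompose p [:1, -1:])"
proof -
  let ?r = "[:1, -1::real:]"
  have d: "pderiv (pcompose q ?r) = - pcompose (pderiv q) ?r" for q
    by (simp add: pderiv_pcompose pderiv_pCons)
  have "poly ([:0, 1, -1:] * pderiv (pderiv (pcompose p ?r))
           + [:a + b + 1 - c, - (a + b + 1):] * pderiv (pcompose p ?r)) x
         = poly (smult (a * b) (pcompose p ?r)) x" for x
  proof -
    have "poly ([:0, 1, -1:] * pderiv (pderiv p) + [:c, - (a + b + 1):] * pderiv p) (1 - x)
           = poly (smult (a * b) p) (1 - x)"
      using assms by (simp add: gauss_equation_def)
    then show ?thesis
      by (simp add: d pderiv_minus poly_pcompose algebra_simps)
  qed
  then show ?thesis
    unfolding gauss_equation_def poly_eq_poly_eq_iff[symmetric] by blast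
qed

text \<open>Reversing the coefficients inverts the term ratio, so the roles of its numerator and denominator
  are exchanged.\<close>

lemma gauss_equation_reverse:
  assumes eq: "gauss_equation (- real n) b c p" and deg: "degree p = n"
  shows "gauss_equation (- real n) (1 - real n - c) (1 - real n - b) (reflect_poly p)"
  unfolding gauss_equation_iff_recurrence
proof
  fix i
  show "(real i + 1) * (real i + (1 - real n - b)) * coeff (reflect_poly p) (Suc i)
      = (real i + - real n) * (real i + (1 - real n - c)) * coeff (reflect_poly p) i"
  proof (cases "i < n")
    case True
    define m where "m = n - Suc i"
    have n: "n = m + Suc i" using True by (simp add: m_def)
    have "(real m + 1) * (real m + c) * coeff p (Suc m)
          = (real m + - real n) * (real m + b) * coeff p m"
      using eq unfolding gauss_equation_iff_recurrence by blast
    then show ?thesis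
      by (simp add: coeff_reflect_poly deg n algebra_simps)
  qed (auto simp: coeff_reflect_poly deg)
qed

text \<open>The only singular points of the equation are \<open>0\<close>, \<open>1\<close> and infinity. At any other point a zero
  of order \<open>m \<ge> 2\<close> is impossible: \<open>p''\<close> has order exactly \<open>m - 2\<close> there, while the equation
  expresses it through \<open>p\<close> and \<open>p'\<close>, which have order at least \<open>m - 1\<close>.\<close>

lemma gauss_equation_zero_simple:
  assumes eq: "gauss_equation a b c p" and "p \<noteq> 0" and x: "x \<noteq> 0" "x \<noteq> 1" and "poly p x = 0"
  shows "poly (pderiv p) x \<noteq> 0"
proof
  assume px: "poly (pderiv p) x = 0"
  have nonconst: "pderiv q \<noteq> 0" if "q \<noteq> 0" "poly q x = 0" for q :: "real poly"
    using that by (auto simp: pderiv_eq_0_iff elim!: degree_eq_zeroE intro!: gr0I)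
  have dp: "pderiv p \<noteq> 0" and ddp: "pderiv (pderiv p) \<noteq> 0"
    using nonconst \<open>p \<noteq> 0\<close> \<open>poly p x = 0\<close> px by blast+
  define r where "r = order x (pderiv (pderiv p))"
  have o1: "order x (pderiv p) = Suc r"
    using order_pderiv[OF dp px] by (simp add: r_def)
  have o0: "order x p = Suc (Suc r)"
    using order_pderiv[OF \<open>p \<noteq> 0\<close> \<open>poly p x = 0\<close>] o1 by simp
  let ?L = "[:- x, 1:] ^ Suc r"
  have "?L dvd pderiv p" "?L dvd p"
    by (simp_all only: order_divides o0 o1) simp_all
  moreover have "[:0, 1, -1:] * pderiv (pderiv p)
      = smult (a * b) p - [:c, - (a + b + 1):] * pderiv p"
    using eq unfolding gauss_equation_def by (simp add: eq_diff_eq)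
  ultimately have "?L dvd [:0, 1, -1:] * pderiv (pderiv p)"
    by (metis dvd_diff dvd_mult dvd_smult)
  moreover have nz: "[:0, 1, -1:] * pderiv (pderiv p) \<noteq> 0"
    using ddp by (simp only: mult_eq_0_iff pCons_eq_0_iff) simp
  ultimately have "Suc r \<le> order x ([:0, 1, -1:] * pderiv (pderiv p))"
    by (simp only: order_divides simp_thms)
  also have "\<dots> = order x [:0, 1, -1:] + r"
    unfolding r_def by (rule order_mult[OF nz])
  also have "order x [:0, 1, -1:] = 0"
    using x by (simp add: order_0I)
  finally show False by simp
qed

section \<open>Counting zeros\<close>

text \<open>Between two consecutive zeros the polynomial would be positive just after the first and negative
  just before the second.\<close>

lemma poly_at_most_one_zero_if_increasing_at_zeros:
  fixes w :: "real poly"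
  assumes pos: "\<And>x. u < x \<Longrightarrow> x < v \<Longrightarrow> poly w x = 0 \<Longrightarrow> poly (pderiv w) x > 0"
    and xy: "u < x" "x < y" "y < v" "poly w x = 0" "poly w y = 0"
  shows False
proof -
  have "w \<noteq> 0" using pos[of x] xy by auto
  define Z where "Z = {t. poly w t = 0} \<inter> {x<..y}"
  have fin: "finite Z" using \<open>w \<noteq> 0\<close> poly_roots_finite by (auto simp: Z_def)
  have "y \<in> Z" using xy by (simp add: Z_def)
  define z where "z = Min Z"
  have zZ: "z \<in> Z" using fin \<open>y \<in> Z\<close> Min_in z_def by blast
  have least: "z \<le> t" if "t \<in> Z" for t using fin that by (simp add: z_def)
  have z: "x < z" "z \<le> y" "poly w z = 0" using zZ by (auto simp: Z_def)
  obtain d where d: "d > 0" "\<And>h. 0 < h \<Longrightarrow> h < d \<Longrightarrow> poly w x < poly w (x + h)"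
    using DERIV_pos_inc_right[OF poly_DERIV[of w x]] pos[of x] xy by force
  obtain e where e: "e > 0" "\<And>h. 0 < h \<Longrightarrow> h < e \<Longrightarrow> poly w (z - h) < poly w z"
    using DERIV_pos_inc_left[OF poly_DERIV[of w z]] pos[of z] xy z by force
  define h where "h = min (min d e) (z - x) / 3"
  have "0 < 3 * h" "3 * h \<le> d" "3 * h \<le> e" "3 * h \<le> z - x"
    using d(1) e(1) z(1) by (simp_all add: h_def)
  then have h: "0 < h" "h < d" "h < e" "x + h < z - h"
    by linarith+
  have "poly w (x + h) > 0" "poly w (z - h) < 0"
    using d(2)[of h] e(2)[of h] h xy z by simp_all
  then obtain t where t: "x + h < t" "t < z - h" "poly w t = 0"
    using poly_IVT_neg[of "x + h" "z - h" w] h by auto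
  then have "t \<in> Z" using h z by (simp add: Z_def)
  then show False using least[of t] t h by simp
qed

text \<open>At a zero of \<open>p p'\<close> either \<open>p = 0 \<noteq> p'\<close>, or \<open>p' = 0\<close> and the equation reduces to
  \<open>x (1 - x) p'' = a b p\<close>. In both cases \<open>(p p')' = p'\<^sup>2 + p p''\<close> is positive.\<close>

lemma unit_interval_at_most_one_zero:
  assumes eq: "gauss_equation a b c p" and "p \<noteq> 0" and ab: "a * b > 0"
    and xy: "0 < x" "x < 1" "poly p x = 0" "0 < y" "y < 1" "poly p y = 0"
  shows "x = y"
proof -
  have pos: "poly (pderiv (p * pderiv p)) t > 0"
    if t: "0 < t" "t < 1" "poly (p * pderiv p) t = 0" for t
  proof (cases "poly p t = 0")
    case True
    then have "poly (pderiv p) t \<noteq> 0"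
      using gauss_equation_zero_simple[OF eq \<open>p \<noteq> 0\<close>] t by simp
    then show ?thesis using True by (simp add: pderiv_mult flip: power2_eq_square)
  next
    case False
    then have d: "poly (pderiv p) t = 0" using t by simp
    have "poly ([:0, 1, -1:] * pderiv (pderiv p) + [:c, - (a + b + 1):] * pderiv p) t
           = poly (smult (a * b) p) t"
      using eq by (simp add: gauss_equation_def)
    then have "t * (1 - t) * poly (pderiv (pderiv p)) t = a * b * poly p t"
      by (simp add: d algebra_simps)
    then have "t * (1 - t) * (poly p t * poly (pderiv (pderiv p)) t) = a * b * (poly p t)\<^sup>2"
      by (simp add: power2_eq_square mult.left_commute)
    moreover have "a * b * (poly p t)\<^sup>2 > 0" "t * (1 - t) > 0"
      using ab False t by simp_all
    ultimately have "poly p t * poly (pderiv (pderiv p)) t > 0"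
      by (metis zero_less_mult_pos)
    then show ?thesis using d by (simp add: pderiv_mult)
  qed
  have "\<not> s < t" if "0 < s" "t < 1" "poly p s = 0" "poly p t = 0" for s t
    using poly_at_most_one_zero_if_increasing_at_zeros[of 0 1 "p * pderiv p" s t] pos that by auto
  then show ?thesis using xy by (meson linorder_neqE)
qed

text \<open>If \<open>p\<close> has equal signs at the endpoints and a zero \<open>x\<close>, then \<open>p / (X - x)\<close> has opposite signs
  there and hence a zero too: a second zero of \<open>p\<close>, or \<open>x\<close> itself as a multiple zero.\<close>

lemma unit_interval_zero_count:
  assumes eq: "gauss_equation a b c p" and ab: "a * b > 0"
    and nz: "poly p 0 * poly p 1 \<noteq> 0"
  shows "card {x. 0 < x \<and> x < 1 \<and> poly p x = 0} = of_bool (poly p 0 * poly p 1 < 0)"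
proof -
  have "p \<noteq> 0" using nz by auto
  note unique = unit_interval_at_most_one_zero[OF eq \<open>p \<noteq> 0\<close> ab]
  show ?thesis
  proof (cases "poly p 0 * poly p 1 < 0")
    case True
    then obtain x where x: "0 < x" "x < 1" "poly p x = 0"
      using poly_IVT[of 0 1 p] by auto
    then have "{x. 0 < x \<and> x < 1 \<and> poly p x = 0} = {x}"
      using unique by blast
    then show ?thesis using True by simp
  next
    case False
    have "poly p x \<noteq> 0" if x: "0 < x" "x < 1" for x
    proof
      assume px: "poly p x = 0"
      then obtain q where q: "p = [:- x, 1:] * q"
        by (metis dvdE poly_eq_0_iff_dvd)
      have "poly p 0 * poly p 1 = - (x * (1 - x) * (poly q 0 * poly q 1))"
        by (simp add: q algebra_simps)
      then have "x * (1 - x) * (poly q 0 * poly q 1) < 0"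
        using nz False by linarith
      then have "poly q 0 * poly q 1 < 0"
        using x by (simp add: mult_less_0_iff)
      then obtain y where y: "0 < y" "y < 1" "poly q y = 0"
        using poly_IVT[of 0 1 q] by auto
      then have "poly p y = 0" by (simp add: q)
      then have "poly q x = 0" using unique x px y by blast
      then have "poly (pderiv p) x = 0" by (simp only: q pderiv_mult) (simp add: pderiv_pCons)
      then show False
        using gauss_equation_zero_simple[OF eq \<open>p \<noteq> 0\<close>] x px by simp
    qed
    then have no_zero: "{x. 0 < x \<and> x < 1 \<and> poly p x = 0} = {}" by blast
    show ?thesis unfolding no_zero using False by simp
  qed
qed

text \<open>The inversion \<open>x \<mapsto> 1/x\<close> carries the zeros to those of the reversed polynomial in \<open>(0,1)\<close>, whose
  value at \<open>0\<close> is the leading coefficient; its parameters have positive product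
  \<open>-n (1 - n - c)\<close> because \<open>1 - n < c\<close>.\<close>

lemma above_one_zero_count:
  assumes eq: "gauss_equation (- real n) b c p" and n: "n > 0" "degree p = n"
    and c: "1 - real n < c" and nz: "poly p 1 \<noteq> 0"
  shows "card {x. 1 < x \<and> poly p x = 0} = of_bool (lead_coeff p * poly p 1 < 0)"
proof -
  have "p \<noteq> 0" using nz by auto
  let ?q = "reflect_poly p"
  have q01: "poly ?q 0 = lead_coeff p" "poly ?q 1 = poly p 1"
    by (simp_all add: poly_reflect_poly_nz)
  have "card {x. 0 < x \<and> x < 1 \<and> poly ?q x = 0} = of_bool (poly ?q 0 * poly ?q 1 < 0)"
    using gauss_equation_reverse[OF eq n(2)] n(1) c nz \<open>p \<noteq> 0\<close>
    by (intro unit_interval_zero_count) (auto simp: q01 mult_less_0_iff)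
  moreover have "card {x. 1 < x \<and> poly p x = 0} = card {x. 0 < x \<and> x < 1 \<and> poly ?q x = 0}"
    by (rule bij_betw_same_card[where f = inverse], rule bij_betw_byWitness[where f' = inverse])
      (auto simp: poly_reflect_poly_nz one_less_inverse inverse_less_1_iff)
  ultimately show ?thesis
    by (simp only: q01)
qed

text \<open>Reflection turns the third parameter into \<open>1 - n + b - c\<close>, and this exceeds \<open>1 - n\<close> exactly
  when \<open>c - b < 0\<close>.\<close>

lemma below_zero_zero_count:
  assumes eq: "gauss_equation (- real n) b c p" and n: "n > 0" "degree p = n"
    and cb: "c - b < 0" and nz: "poly p 0 \<noteq> 0"
  shows "card {x. x < 0 \<and> poly p x = 0} = of_bool ((-1) ^ n * lead_coeff p * poly p 0 < 0)"
proof -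
  let ?q = "pcompose p [:1, -1:]"
  have deg: "degree ?q = n" using n by (simp add: degree_pcompose)
  have lc: "lead_coeff ?q = (-1) ^ n * lead_coeff p"
    using lead_coeff_comp[of "[:1, -1:]" p] n by simp
  have q1: "poly ?q 1 = poly p 0" by (simp add: poly_pcompose)
  have "card {x. 1 < x \<and> poly ?q x = 0} = of_bool (lead_coeff ?q * poly ?q 1 < 0)"
    by (rule above_one_zero_count[OF gauss_equation_reflect[OF eq] n(1) deg])
      (use cb nz q1 in auto)
  moreover have "card {x. x < 0 \<and> poly p x = 0} = card {x. 1 < x \<and> poly ?q x = 0}"
    by (rule bij_betw_same_card[where f = "\<lambda>x. 1 - x"],
        rule bij_betw_byWitness[where f' = "\<lambda>x. 1 - x"]) (auto simp: poly_pcompose)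
  ultimately show ?thesis
    by (simp only: lc q1)
qed

section \<open>The hypergeometric polynomial\<close>

definition real_hyp_poly :: "nat \<Rightarrow> real \<Rightarrow> real \<Rightarrow> real poly" where
  "real_hyp_poly n b c =
     (\<Sum>i\<le>n. monom (pochhammer (- real n) i * pochhammer b i / (pochhammer c i * fact i)) i)"

lemma hyp_poly_of_real: "hyp_poly n b c (of_real x) = of_real (poly (real_hyp_poly n b c) x)"
proof -
  have "poly (real_hyp_poly n b c) x
      = (\<Sum>i = 0..n. pochhammer (- real n) i * pochhammer b i / (pochhammer c i * fact i) * x ^ i)"
    by (simp add: real_hyp_poly_def poly_sum poly_monom atMost_atLeast0)
  also have "\<dots> = 1 + (\<Sum>i = 1..n. pochhammer (- real n) i * pochhammer b i / pochhammer c i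
                          * x ^ i / fact i)"
    by (simp add: sum.atLeast_Suc_atMost mult.commute)
  finally show ?thesis
    by (simp add: hyp_poly_def)
qed

text \<open>The formula also holds for \<open>i > n\<close>, where \<open>(-n)\<^sub>i = 0\<close>.\<close>

lemma coeff_real_hyp_poly:
  "coeff (real_hyp_poly n b c) i
     = pochhammer (- real n) i * pochhammer b i / (pochhammer c i * fact i)"
  by (auto simp: real_hyp_poly_def coeff_sum pochhammer_of_nat_eq_0_iff)

lemma gauss_equation_real_hyp_poly:
  assumes "\<And>i. c \<noteq> - real i"
  shows "gauss_equation (- real n) b c (real_hyp_poly n b c)"
proof -
  have "pochhammer c i \<noteq> 0" "c + real i \<noteq> 0" for i
    using assms by (auto simp: pochhammer_eq_0_iff add_eq_0_iff2)
  then show ?thesis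
    by (auto simp: gauss_equation_iff_recurrence coeff_real_hyp_poly pochhammer_Suc
        divide_simps) (simp_all add: algebra_simps)
qed

lemma poly_real_hyp_poly_1:
  assumes "\<And>i. c \<noteq> - real i"
  shows "poly (real_hyp_poly n b c) 1 = pochhammer (c - b) n / pochhammer c n"
  using Vandermonde_pochhammer[of n c b] assms
  by (simp add: real_hyp_poly_def poly_sum poly_monom atMost_atLeast0 mult.commute)

lemma sgn_pochhammer:
  fixes x :: real
  assumes "- real j < x" "x < - real j + 1" "j \<le> n"
  shows "sgn (pochhammer x n) = (-1) ^ j"
proof -
  have "sgn (pochhammer x m) = (-1) ^ min m j" for m
  proof (induction m)
    case (Suc m)
    show ?case
    proof (cases "m < j")
      case True
      then have "x + real m < 0" using assms by linarith
      then show ?thesis using Suc True by (simp add: pochhammer_Suc sgn_mult)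
    next
      case False
      then have "x + real m > 0" using assms by linarith
      then show ?thesis using Suc False by (simp add: pochhammer_Suc sgn_mult min_def)
    qed
  qed simp
  then show ?thesis using assms(3) by (simp add: min_def)
qed

theorem theorem3p4:
  fixes n j k l :: nat and b c :: real and F :: "complex \<Rightarrow> complex"
  assumes n: "n \<ge> 1"
    and F: "F = hyp_poly n b c"
    and cb: "1 - real n < c - b" "c - b < 0"
    and b: "1 - real n < b" "b < 0"
    and c: "1 - real n < c" "c < 0"
    and j: "j \<in> {1..n - 1}" "- real j < b" "b < - real j + 1"
    and k: "k \<in> {1..n - 1}" "- real k < c" "c < - real k + 1"
    and l: "l \<in> {1..n - 1}" "- real l < c - b" "c - b < - real l + 1"
  shows "(even (n + j + l) \<and> even (k + l) \<and> even (j + k)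
            \<longrightarrow> \<not> (\<exists>x::real. F (of_real x) = 0))
       \<and> (odd (n + j + l) \<longrightarrow> (\<exists>!x::real. x \<in> {1<..} \<and> F (of_real x) = 0))
       \<and> (odd (k + l) \<longrightarrow> (\<exists>!x::real. x \<in> {0<..<1} \<and> F (of_real x) = 0))
       \<and> (odd (j + k) \<longrightarrow> (\<exists>!x::real. x < 0 \<and> F (of_real x) = 0))"
proof -
  have not_neg_nat: "c \<noteq> - real i" for i
  proof
    assume "c = - real i"
    then have "real i < real k" "real k < real (Suc i)" using k by simp_all
    then show False unfolding of_nat_less_iff by linarith
  qed
  have npos: "n > 0" using n by simp
  let ?p = "real_hyp_poly n b c"
  have root: "F (of_real x) = 0 \<longleftrightarrow> poly ?p x = 0" for x
    by (simp add: F hyp_poly_of_real)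
  note eq = gauss_equation_real_hyp_poly[OF not_neg_nat, of n b]

  have sb: "sgn (pochhammer b n) = (-1) ^ j"
    using sgn_pochhammer[of j b n] j by force
  have sc: "sgn (pochhammer c n) = (-1) ^ k"
    using sgn_pochhammer[of k c n] k by force
  have scb: "sgn (pochhammer (c - b) n) = (-1) ^ l"
    using sgn_pochhammer[of l "c - b" n] l by force

  have p0: "poly ?p 0 = 1"
    by (simp add: poly_0_coeff_0 coeff_real_hyp_poly)
  have s1: "sgn (poly ?p 1) = (-1) ^ (k + l)"
    by (simp add: poly_real_hyp_poly_1[OF not_neg_nat] divide_inverse sgn_mult sgn_inverse sc scb
        power_add mult.commute flip: power_inverse)
  have sn: "sgn (coeff ?p n) = (-1) ^ (n + j + k)"
    by (simp add: coeff_real_hyp_poly pochhammer_same divide_inverse sgn_mult sgn_inverse sb sc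
        power_add flip: power_inverse)
  have p1: "poly ?p 1 \<noteq> 0"
    using s1 by (metis power_not_zero sgn_0 zero_neq_neg_one)
  have pn: "coeff ?p n \<noteq> 0"
    using sn by (metis power_not_zero sgn_0 zero_neq_neg_one)
  have deg: "degree ?p = n"
    using pn by (intro antisym le_degree degree_le)
      (auto simp: coeff_real_hyp_poly pochhammer_of_nat_eq_0_iff)

  have neg: "y < 0 \<longleftrightarrow> odd m" if "sgn y = (-1) ^ m" for y :: real and m :: nat
    using that by (cases "even m") (auto simp: sgn_if split: if_splits)
  have unit: "card {x. 0 < x \<and> x < 1 \<and> poly ?p x = 0} = of_bool (odd (k + l))"
  proof -
    have ab: "- real n * b > 0" using n b by (intro mult_neg_neg) simp_all
    show ?thesis
      using unit_interval_zero_count[OF eq ab] p1 by (simp only: p0 mult_1 neg[OF s1] simp_thms)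
  qed
  (* The denominator (c)_n occurs in both factors, which contributes the even exponent 2 k. *)
  have "sgn (lead_coeff ?p * poly ?p 1) = (-1) ^ (n + j + l + 2 * k)"
    by (simp add: deg sgn_mult sn s1 power_add mult_2)
  from neg[OF this] have "lead_coeff ?p * poly ?p 1 < 0 \<longleftrightarrow> odd (n + j + l)" by simp
  then have above: "card {x. 1 < x \<and> poly ?p x = 0} = of_bool (odd (n + j + l))"
    using above_one_zero_count[OF eq npos deg c(1) p1] by (simp only:)
  (* Here the factor (-1)^n of the leading coefficient is cancelled by the reflection x -> 1 - x. *)
  have "sgn ((-1) ^ n * lead_coeff ?p * poly ?p 0) = (-1) ^ (j + k + 2 * n)"
    by (simp add: deg sgn_mult sn p0 power_add mult_2)
  from neg[OF this] have "(-1) ^ n * lead_coeff ?p * poly ?p 0 < 0 \<longleftrightarrow> odd (j + k)" by simp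
  moreover have "poly ?p 0 \<noteq> 0" by (simp add: p0)
  ultimately have below: "card {x. x < 0 \<and> poly ?p x = 0} = of_bool (odd (j + k))"
    using below_zero_zero_count[OF eq npos deg cb(2)] by (simp only: simp_thms)

  have "?p \<noteq> 0" using p1 by auto
  then have fin: "finite {x. P x \<and> poly ?p x = 0}" for P
    using poly_roots_finite[of ?p] by (rule_tac finite_subset) auto
  have none: "\<not> (P x \<and> poly ?p x = 0)" if "card {x. P x \<and> poly ?p x = 0} = 0" for P x
    using that fin[of P] by auto
  have one: "\<exists>!x. P x \<and> poly ?p x = 0" if card1: "card {x. P x \<and> poly ?p x = 0} = 1" for P
  proof -
    obtain x where "{x. P x \<and> poly ?p x = 0} = {x}"
      using card1 by (rule card_1_singletonE)
    then show ?thesis by (intro ex1I[of _ x]) auto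
  qed
  show ?thesis
  proof (intro conjI impI)
    assume ev: "even (n + j + l) \<and> even (k + l) \<and> even (j + k)"
    show "\<not> (\<exists>x::real. F (of_real x) = 0)"
    proof
      assume "\<exists>x::real. F (of_real x) = 0"
      then obtain x where x: "poly ?p x = 0" using root by blast
      consider "x < 0" | "x = 0" | "0 < x \<and> x < 1" | "x = 1" | "1 < x" by linarith
      then show False
      proof cases
        case 1
        moreover have "card {x. x < 0 \<and> poly ?p x = 0} = 0"
          using below ev by (simp only: simp_thms of_bool_eq)
        ultimately show False using none[of "\<lambda>x. x < 0" x] x unfolding conj_assoc by blast
      next
        case 2
        then show False using p0 x by simp
      next
        case 3
        moreover have "card {x. 0 < x \<and> x < 1 \<and> poly ?p x = 0} = 0"
          using unit ev by (simp only: simp_thms of_bool_eq)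
        ultimately show False using none[of "\<lambda>x. 0 < x \<and> x < 1" x] x unfolding conj_assoc by blast
      next
        case 4
        then show False using p1 x by simp
      next
        case 5
        moreover have "card {x. 1 < x \<and> poly ?p x = 0} = 0"
          using above ev by (simp only: simp_thms of_bool_eq)
        ultimately show False using none[of "\<lambda>x. 1 < x" x] x unfolding conj_assoc by blast
      qed
    qed
  next
    assume "odd (n + j + l)"
    then show "\<exists>!x::real. x \<in> {1<..} \<and> F (of_real x) = 0"
      using one[of "\<lambda>x. 1 < x"] above by (simp add: root)
  next
    assume "odd (k + l)"
    then show "\<exists>!x::real. x \<in> {0<..<1} \<and> F (of_real x) = 0"
      using one[of "\<lambda>x. 0 < x \<and> x < 1"] unit by (simp add: root conj_assoc)
  next
    assume "odd (j + k)"
    then show "\<exists>!x::real. x < 0 \<and> F (of_real x) = 0"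
      using one[of "\<lambda>x. x < 0"] below by (simp add: root)
  qed
qed

end
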